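(* Let $H$ be a decomposition monoid. For every $n\geq 1$ and $s_1,\dots,s_n,t_1,\dots,t_n\in\mathcal{S}(H)$ such that $s_i,s_j$ are relatively prime and $t_i,t_j$ are relatively prime for all $i\neq j$, if $$s_1s_2^2s_3^3\cdots s_n^n\sim t_1t_2^2t_3^3\cdots t_n^n,$$ then $s_i\sim t_i$ for $i=1,\dots,n$.
   Context: Monoid means commutative cancellative monoid (written multiplicatively). $H^{\times}$ denotes the group of invertible elements of $H$. $H$ is a decomposition monoid if for all $a,b,c\in H$ with $a\mid bc$ there exist $a_1,a_2\in H$ with $a=a_1a_2$, $a_1\mid b$ and $a_2\mid c$. An element $a\in H$ is square-free if it cannot be written as $a=b^2c$ with $b,c\in H$ and $b\notin H^{\times}$; $\mathcal{S}(H)$ is the set of square-free elements. Two elements are relatively prime if they have no common non-invertible divisor. $a\sim b$ means $a=ub$ for some $u\in H^{\times}$. *)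

theory Defs
  imports "HOL-Algebra.Divisibility" "HOL-Algebra.FiniteProduct"
begin

text \<open>
  Divisibility and association are those of \<^theory>\<open>HOL-Algebra.Divisibility\<close>.
  There \<open>a \<sim> b\<close> is defined as mutual divisibility; in a cancellative monoid this is the
  relation \<open>a = u \<otimes> b\<close> for a unit \<open>u\<close>, see \<open>associated_iff_unit\<close> below.
\<close>

locale decomposition_monoid = comm_monoid_cancel H for H (structure) +
  assumes decomposition:
    "\<lbrakk>a \<in> carrier H; b \<in> carrier H; c \<in> carrier H; a divides (b \<otimes> c)\<rbrakk>
      \<Longrightarrow> \<exists>a1\<in>carrier H. \<exists>a2\<in>carrier H. a = a1 \<otimes> a2 \<and> a1 divides b \<and> a2 divides c"

definition squarefree_elements :: "('a, 'm) monoid_scheme \<Rightarrow> 'a set" where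
  "squarefree_elements H =
    {a \<in> carrier H. \<not> (\<exists>b\<in>carrier H. \<exists>c\<in>carrier H.
       a = b [^]\<^bsub>H\<^esub> (2::nat) \<otimes>\<^bsub>H\<^esub> c \<and> b \<notin> Units H)}"

definition relatively_prime :: "('a, 'm) monoid_scheme \<Rightarrow> 'a \<Rightarrow> 'a \<Rightarrow> bool" where
  "relatively_prime H a b \<longleftrightarrow>
    \<not> (\<exists>d\<in>carrier H. d divides\<^bsub>H\<^esub> a \<and> d divides\<^bsub>H\<^esub> b \<and> d \<notin> Units H)"

lemma (in comm_monoid_cancel) associated_iff_unit:
  assumes "a \<in> carrier G" "b \<in> carrier G"
  shows "a \<sim> b \<longleftrightarrow> (\<exists>u\<in>Units G. a = u \<otimes> b)"
  using assms associated_iff[OF assms] by (metis Units_closed m_comm)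

end

theory Submission
  imports Defs
begin

text \<open>
  In a decomposition monoid relative primeness is inherited by products and powers, and
  \<open>a\<close> dividing \<open>b \<otimes> c\<close> with \<open>a\<close>, \<open>b\<close> relatively prime divides \<open>c\<close>.
  The key point is that \<open>s i\<close> and \<open>t j\<close> are relatively prime for \<open>i \<noteq> j\<close>: if, say, \<open>j < i\<close> and \<open>x\<close> divides both,
  then \<open>x [^] i\<close> is prime to all \<open>t k\<close> with \<open>k \<noteq> j\<close>, so it divides \<open>t j [^] j\<close>; but
  \<open>t j = x \<otimes> y\<close> with \<open>x\<close>, \<open>y\<close> relatively prime, and cancelling \<open>x [^] j\<close> leaves \<open>x\<close> dividing
  \<open>y [^] j\<close>, so \<open>x\<close> is a unit. Hence \<open>s i\<close> divides \<open>t i [^] i\<close> and, being square-free, \<open>t i\<close>;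
  the situation is symmetric.
\<close>

section \<open>Divisibility, relative primeness and square-free elements in cancellative
  monoids\<close>

lemma relatively_prime_sym: "relatively_prime G a b \<Longrightarrow> relatively_prime G b a"
  unfolding relatively_prime_def by blast

lemma relatively_primeD:
  "\<lbrakk>relatively_prime G a b; d \<in> carrier G; d divides\<^bsub>G\<^esub> a; d divides\<^bsub>G\<^esub> b\<rbrakk> \<Longrightarrow> d \<in> Units G"
  unfolding relatively_prime_def by blast

lemma squarefree_elements_closed: "a \<in> squarefree_elements G \<Longrightarrow> a \<in> carrier G"
  unfolding squarefree_elements_def by blast

context comm_monoid_cancel
begin

lemma relatively_prime_divides:
  assumes "relatively_prime G a b" "x divides a"
  shows "relatively_prime G x b"
  unfolding relatively_prime_def
  using relatively_primeD[OF assms(1)] divides_trans[OF _ assms(2)] by simp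

lemma divides_nat_pow:
  assumes "a \<in> carrier G" "0 < (k::nat)"
  shows "a divides a [^] k"
proof -
  obtain m where m: "k = Suc m"
    using assms(2) gr0_implies_Suc by blast
  show ?thesis
    unfolding m by (rule dividesI[of "a [^] m"]) (use assms(1) nat_pow_Suc2 in auto)
qed

lemma nat_pow_divides_mono:
  assumes "a divides b" "a \<in> carrier G"
  shows "a [^] (k::nat) divides b [^] k"
proof -
  obtain c where c: "c \<in> carrier G" "b = a \<otimes> c"
    using assms(1) by (auto elim: dividesE)
  then have "b [^] k = a [^] k \<otimes> c [^] k"
    using assms(2) by (simp add: nat_pow_distrib)
  then show ?thesis
    using c by (auto intro: dividesI)
qed

lemma finprod_remove:
  assumes "finite A" "j \<in> A" "\<And>k. k \<in> A \<Longrightarrow> f k \<in> carrier G"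
  shows "(\<Otimes>k\<in>A. f k) = f j \<otimes> (\<Otimes>k\<in>A - {j}. f k)"
proof -
  have "(\<Otimes>k\<in>insert j (A - {j}). f k) = f j \<otimes> (\<Otimes>k\<in>A - {j}. f k)"
    by (rule finprod_insert) (use assms in auto)
  then show ?thesis
    using assms(2) by (simp add: insert_absorb)
qed

lemma squarefree_divides:
  assumes "a \<in> squarefree_elements G" "x \<in> carrier G" "x divides a"
  shows "x \<in> squarefree_elements G"
proof -
  obtain y where y: "y \<in> carrier G" "a = x \<otimes> y"
    using assms(3) by (auto elim: dividesE)
  have "b \<in> Units G" if "b \<in> carrier G" "c \<in> carrier G" "x = b [^] (2::nat) \<otimes> c" for b c
  proof -
    have "a = b [^] (2::nat) \<otimes> (c \<otimes> y)"
      using that y by (simp add: m_assoc)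
    then show ?thesis
      using assms(1) that y unfolding squarefree_elements_def by blast
  qed
  then show ?thesis
    using assms(2) unfolding squarefree_elements_def by blast
qed

text \<open>The square of a common divisor of the two factors divides their product, so
  square-freeness forces that divisor to be a unit.\<close>

lemma squarefree_mult_relatively_prime:
  assumes "a \<otimes> b \<in> squarefree_elements G" "a \<in> carrier G" "b \<in> carrier G"
  shows "relatively_prime G a b"
proof -
  have "d \<in> Units G" if d: "d \<in> carrier G" "d divides a" "d divides b" for d
  proof -
    obtain p where p: "p \<in> carrier G" "a = d \<otimes> p"
      using d(2) by (auto elim: dividesE)
    obtain q where q: "q \<in> carrier G" "b = d \<otimes> q"
      using d(3) by (auto elim: dividesE)
    have "a \<otimes> b = d [^] (2::nat) \<otimes> (p \<otimes> q)"
      using p q d(1) by (simp add: numeral_2_eq_2 m_ac)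
    then show ?thesis
      using assms(1) d(1) p q unfolding squarefree_elements_def by blast
  qed
  then show ?thesis
    unfolding relatively_prime_def by blast
qed

end

section \<open>Relative primeness in decomposition monoids\<close>

context decomposition_monoid
begin

text \<open>Split \<open>a\<close> along \<open>b \<otimes> c\<close> by the decomposition property.
  The part dividing \<open>b\<close> is a common divisor of \<open>a\<close> and \<open>b\<close>,
  hence a unit, so \<open>a\<close> is associated to the part dividing \<open>c\<close>.\<close>

lemma relatively_prime_dvd_mult:
  assumes "relatively_prime H a b" "a divides b \<otimes> c"
    and "a \<in> carrier H" "b \<in> carrier H" "c \<in> carrier H"
  shows "a divides c"
proof -
  obtain a1 a2 where a: "a1 \<in> carrier H" "a2 \<in> carrier H" "a = a1 \<otimes> a2" "a1 divides b" "a2 divides c"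
    using decomposition[of a b c] assms by blast
  have "a1 \<in> Units H"
    using relatively_primeD[OF assms(1) a(1) _ a(4)] a(2,3) dividesI' by blast
  then have "a \<sim> a2"
    unfolding a(3) associated_iff_unit[OF m_closed[OF a(1,2)] a(2)] by blast
  then show ?thesis
    using divides_trans[OF associatedD _ assms(3)] a(5) by blast
qed

text \<open>A common divisor of \<open>a\<close> and \<open>b \<otimes> c\<close> inherits from
  \<open>a\<close> its primeness to \<open>b\<close>; it can therefore be pushed into
  \<open>c\<close>, where primeness of \<open>a\<close> and \<open>c\<close> makes it a
  unit.\<close>

lemma relatively_prime_mult:
  assumes "relatively_prime H a b" "relatively_prime H a c"
    and "a \<in> carrier H" "b \<in> carrier H" "c \<in> carrier H"
  shows "relatively_prime H a (b \<otimes> c)"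
proof -
  have "d \<in> Units H" if d: "d \<in> carrier H" "d divides a" "d divides b \<otimes> c" for d
  proof -
    have "relatively_prime H d b"
      by (rule relatively_prime_divides[OF assms(1) d(2)])
    then have "d divides c"
      using relatively_prime_dvd_mult[OF _ d(3,1) assms(4,5)] by blast
    then show ?thesis
      using relatively_primeD[OF assms(2) d(1,2)] by blast
  qed
  then show ?thesis
    unfolding relatively_prime_def by blast
qed

lemma relatively_prime_one: "a \<in> carrier H \<Longrightarrow> relatively_prime H a \<one>"
  by (simp add: relatively_prime_def Unit_eq_dividesone)

lemma relatively_prime_pow:
  assumes "relatively_prime H a b" "a \<in> carrier H" "b \<in> carrier H"
  shows "relatively_prime H a (b [^] (k::nat))"
proof (induction k)
  case 0
  show ?case
    using relatively_prime_one[OF assms(2)] by simp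
next
  case (Suc k)
  show ?case
    using relatively_prime_mult[OF Suc assms(1,2) nat_pow_closed[OF assms(3)] assms(3)] by simp
qed

lemma relatively_prime_finprod:
  assumes "finite A" "a \<in> carrier H"
    and "\<And>k. k \<in> A \<Longrightarrow> f k \<in> carrier H" "\<And>k. k \<in> A \<Longrightarrow> relatively_prime H a (f k)"
  shows "relatively_prime H a (\<Otimes>k\<in>A. f k)"
  using assms
  by (induction A) (auto simp: relatively_prime_one relatively_prime_mult finprod_closed Pi_def)

lemma relatively_prime_finprod_dvd:
  assumes "finite A" "j \<in> A" "a \<in> carrier H"
    and f: "\<And>k. k \<in> A \<Longrightarrow> f k \<in> carrier H"
    and rp: "\<And>k. k \<in> A - {j} \<Longrightarrow> relatively_prime H a (f k)"
    and dvd: "a divides (\<Otimes>k\<in>A. f k)"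
  shows "a divides f j"
proof -
  let ?r = "\<Otimes>k\<in>A - {j}. f k"
  have r: "?r \<in> carrier H"
    using f by (auto intro: finprod_closed)
  have "a divides ?r \<otimes> f j"
    using dvd finprod_remove[OF assms(1,2) f] m_comm[OF r f[OF assms(2)]] by simp
  moreover have "relatively_prime H a ?r"
    by (rule relatively_prime_finprod) (use assms in auto)
  ultimately show ?thesis
    using relatively_prime_dvd_mult r f assms(2,3) by blast
qed

text \<open>Induction on \<open>k\<close>, with \<open>a\<close> arbitrary because the induction
  hypothesis is applied to a factor \<open>a1\<close> of \<open>a\<close>, which is again
  square-free.\<close>

lemma squarefree_dvd_pow:
  assumes "a \<in> squarefree_elements H" "b \<in> carrier H" "a divides b [^] (k::nat)"
  shows "a divides b"
  using assms(1,3)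
proof (induction k arbitrary: a)
  case 0
  \<comment> \<open>Here \<open>a\<close> divides \<open>\<one>\<close>, so it is a unit and divides
    everything.\<close>
  then show ?case
    by (metis Unit_eq_dividesone assms(2) nat_pow_0 squarefree_elements_closed unit_divides)
next
  case (Suc k)
  have "a divides b [^] k \<otimes> b" "a \<in> carrier H"
    using Suc.prems squarefree_elements_closed by auto
  then obtain a1 a2 where a: "a1 \<in> carrier H" "a2 \<in> carrier H" "a = a1 \<otimes> a2"
    "a1 divides b [^] k" "a2 divides b"
    using decomposition[of a "b [^] k" b] assms(2) by auto
  have "a1 divides b"
  proof (rule Suc.IH)
    show "a1 \<in> squarefree_elements H"
      using squarefree_divides[OF Suc.prems(1) a(1)] a(2,3) dividesI' by blast
  qed (rule a(4))
  moreover obtain c where c: "c \<in> carrier H" "b = a2 \<otimes> c"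
    using a(5) by (auto elim: dividesE)
  \<comment> \<open>Both \<open>a1\<close> and \<open>a2\<close> divide \<open>b\<close>; their
    relative primeness, which comes from square-freeness of \<open>a\<close>, is what makes the
    product divide \<open>b\<close> too.\<close>
  moreover have "relatively_prime H a1 a2"
    using squarefree_mult_relatively_prime Suc.prems(1) a(1,2) unfolding a(3) by blast
  ultimately have "a1 divides c"
    using a relatively_prime_dvd_mult by blast
  then show ?case
    unfolding c(2) a(3) m_comm[OF a(1,2)] using a c by (simp only: divides_mult_l)
qed

section \<open>Comparing the two products of powers\<close>

lemma finprod_pow_dvd:
  fixes s t :: "nat \<Rightarrow> 'a"
  assumes "finite A" "i \<in> A"
    and "\<And>i. i \<in> A \<Longrightarrow> s i \<in> carrier H" "\<And>i. i \<in> A \<Longrightarrow> t i \<in> carrier H"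
    and "(\<Otimes>i\<in>A. s i [^] i) \<sim> (\<Otimes>i\<in>A. t i [^] i)"
  shows "s i [^] i divides (\<Otimes>i\<in>A. t i [^] i)"
proof -
  have c: "(\<Otimes>i\<in>A. s i [^] i) \<in> carrier H" "(\<Otimes>i\<in>A. t i [^] i) \<in> carrier H"
    using assms by (auto intro: finprod_closed)
  have r: "(\<Otimes>k\<in>A - {i}. s k [^] k) \<in> carrier H"
    using assms by (auto intro: finprod_closed)
  have "(\<Otimes>k\<in>A. s k [^] k) = s i [^] i \<otimes> (\<Otimes>k\<in>A - {i}. s k [^] k)"
    by (rule finprod_remove) (use assms in auto)
  then have "s i [^] i divides (\<Otimes>k\<in>A. s k [^] k)"
    using r by (rule dividesI')
  then show ?thesis
    using c assms by (meson associatedD divides_trans nat_pow_closed)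
qed

text \<open>Formulated for a single family, so that both orders of the two indices are instances of
  it.\<close>

lemma common_divisor_unit:
  fixes t :: "nat \<Rightarrow> 'a"
  assumes "finite A" "j \<in> A" "j < i" "x \<in> carrier H"
    and t: "\<And>k. k \<in> A \<Longrightarrow> t k \<in> squarefree_elements H"
    and rp: "\<And>k l. k \<in> A \<Longrightarrow> l \<in> A \<Longrightarrow> k \<noteq> l \<Longrightarrow> relatively_prime H (t k) (t l)"
    and dvd: "x [^] i divides (\<Otimes>k\<in>A. t k [^] k)" and xt: "x divides t j"
  shows "x \<in> Units H"
proof -
  have tc: "t k \<in> carrier H" if "k \<in> A" for k
    by (rule squarefree_elements_closed[OF t[OF that]])
  have "relatively_prime H (x [^] i) (t k [^] k)" if k: "k \<in> A - {j}" for k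
  proof -
    have kA: "k \<in> A" and jk: "j \<noteq> k"
      using k by auto
    have "relatively_prime H x (t k)"
      by (rule relatively_prime_divides[OF rp[OF assms(2) kA jk] xt])
    then have "relatively_prime H (t k) (x [^] i)"
      by (rule relatively_prime_pow[OF relatively_prime_sym tc[OF kA] assms(4)])
    then show ?thesis
      by (rule relatively_prime_pow[OF relatively_prime_sym nat_pow_closed[OF assms(4)] tc[OF kA]])
  qed
  then have d: "x [^] i divides t j [^] j"
    using relatively_prime_finprod_dvd[of A j "x [^] i" "\<lambda>k. t k [^] k"] assms tc by auto
  obtain y where y: "y \<in> carrier H" "t j = x \<otimes> y"
    using xt by (auto elim: dividesE)
  \<comment> \<open>The surplus exponent \<open>Suc m\<close> is positive, so at least one factor
    \<open>x\<close> survives the cancellation of \<open>x [^] j\<close>.\<close>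
  obtain m where m: "i = j + Suc m"
    using assms(3) less_imp_Suc_add by auto
  have "x [^] j \<otimes> x [^] Suc m divides x [^] j \<otimes> y [^] j"
    using d y assms(4) unfolding m by (simp only: nat_pow_mult nat_pow_distrib)
  then have "x [^] Suc m divides y [^] j"
    using assms(4) y(1) by (simp only: divides_mult_l nat_pow_closed)
  moreover have "x divides x [^] Suc m"
    using assms(4) by (rule divides_nat_pow) simp
  ultimately have "x divides y [^] j"
    using divides_trans assms(4) by blast
  moreover have "relatively_prime H x y"
    using squarefree_mult_relatively_prime t[OF assms(2)] y(1) assms(4) unfolding y(2) by blast
  then have "relatively_prime H x (y [^] j)"
    using relatively_prime_pow assms(4) y(1) by blast
  ultimately show ?thesis
    using relatively_primeD[OF _ assms(4) divides_refl[OF assms(4)]] by blast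
qed

text \<open>One half of the association. The hypotheses are symmetric in \<open>s\<close> and
  \<open>t\<close>, so exchanging the families yields the other half.\<close>

lemma squarefree_factor_dvd:
  fixes s t :: "nat \<Rightarrow> 'a"
  assumes "finite A" "0 < i" "i \<in> A"
    and s: "\<And>i. i \<in> A \<Longrightarrow> s i \<in> squarefree_elements H"
    and t: "\<And>i. i \<in> A \<Longrightarrow> t i \<in> squarefree_elements H"
    and rs: "\<And>i j. i \<in> A \<Longrightarrow> j \<in> A \<Longrightarrow> i \<noteq> j \<Longrightarrow> relatively_prime H (s i) (s j)"
    and rt: "\<And>i j. i \<in> A \<Longrightarrow> j \<in> A \<Longrightarrow> i \<noteq> j \<Longrightarrow> relatively_prime H (t i) (t j)"
    and eq: "(\<Otimes>i\<in>A. s i [^] i) \<sim> (\<Otimes>i\<in>A. t i [^] i)"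
  shows "s i divides t i"
proof -
  have sc: "s k \<in> carrier H" and tc: "t k \<in> carrier H" if "k \<in> A" for k
    by (fact squarefree_elements_closed[OF s[OF that]] squarefree_elements_closed[OF t[OF that]])+
  have eq': "(\<Otimes>i\<in>A. t i [^] i) \<sim> (\<Otimes>i\<in>A. s i [^] i)"
    using eq by (rule associated_sym)
  have st: "s k [^] k divides (\<Otimes>i\<in>A. t i [^] i)" if "k \<in> A" for k
    by (rule finprod_pow_dvd) (use assms(1) that sc tc eq in auto)
  have ts: "t k [^] k divides (\<Otimes>i\<in>A. s i [^] i)" if "k \<in> A" for k
    by (rule finprod_pow_dvd) (use assms(1) that sc tc eq' in auto)
  \<comment> \<open>The power of \<open>x\<close> must carry the larger index: for
    \<open>j < i\<close> it comes from \<open>s i [^] i\<close> and is compared with the family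
    \<open>t\<close>, otherwise from \<open>t j [^] j\<close> and is compared with
    \<open>s\<close>.\<close>
  have unit: "x \<in> Units H"
    if "j \<in> A" "i \<noteq> j" and x: "x \<in> carrier H" "x divides s i" "x divides t j" for x j
  proof (cases "j < i")
    case True
    have dvd: "x [^] i divides (\<Otimes>k\<in>A. t k [^] k)"
      using nat_pow_divides_mono[OF x(2,1)] st[OF assms(3)] divides_trans x(1) by blast
    show ?thesis
      by (rule common_divisor_unit[where t = t, OF assms(1) \<open>j \<in> A\<close> True x(1) t rt dvd x(3)])
  next
    case False
    then have "i < j"
      using \<open>i \<noteq> j\<close> by simp
    have dvd: "x [^] j divides (\<Otimes>k\<in>A. s k [^] k)"
      using nat_pow_divides_mono[OF x(3,1)] ts[OF \<open>j \<in> A\<close>] divides_trans x(1) by blast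
    show ?thesis
      by (rule common_divisor_unit[where t = s, OF assms(1,3) \<open>i < j\<close> x(1) s rs dvd x(2)])
  qed
  have rp: "relatively_prime H (s i) (t k [^] k)" if "k \<in> A - {i}" for k
  proof -
    have k: "k \<in> A" "i \<noteq> k"
      using that by auto
    have "relatively_prime H (s i) (t k)"
      unfolding relatively_prime_def using unit[OF k] by blast
    then show ?thesis
      by (rule relatively_prime_pow[OF _ sc[OF assms(3)] tc[OF k(1)]])
  qed
  \<comment> \<open>Positivity of \<open>i\<close> enters here: it lets \<open>s i\<close> divide
    \<open>s i [^] i\<close>.\<close>
  have "s i divides (\<Otimes>k\<in>A. t k [^] k)"
    using divides_nat_pow[OF sc[OF assms(3)] assms(2)] st[OF assms(3)] sc[OF assms(3)]
      divides_trans by blast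
  then have "s i divides t i [^] i"
    using relatively_prime_finprod_dvd[of A i "s i" "\<lambda>k. t k [^] k"] assms(1,3) sc tc rp by auto
  then show ?thesis
    by (rule squarefree_dvd_pow[OF s[OF assms(3)] tc[OF assms(3)]])
qed

end

theorem proposition6p6:
  fixes H :: "('a, 'm) monoid_scheme" (structure)
    and n :: nat
    and s t :: "nat \<Rightarrow> 'a"
  assumes "decomposition_monoid H"
    and "n \<ge> 1"
    and "\<And>i. i \<in> {1..n} \<Longrightarrow> s i \<in> squarefree_elements H"
    and "\<And>i. i \<in> {1..n} \<Longrightarrow> t i \<in> squarefree_elements H"
    and "\<And>i j. i \<in> {1..n} \<Longrightarrow> j \<in> {1..n} \<Longrightarrow> i \<noteq> j \<Longrightarrow> relatively_prime H (s i) (s j)"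
    and "\<And>i j. i \<in> {1..n} \<Longrightarrow> j \<in> {1..n} \<Longrightarrow> i \<noteq> j \<Longrightarrow> relatively_prime H (t i) (t j)"
    and "(\<Otimes>i\<in>{1..n}. s i [^] i) \<sim> (\<Otimes>i\<in>{1..n}. t i [^] i)"
  shows "\<forall>i\<in>{1..n}. s i \<sim> t i"
proof
  interpret decomposition_monoid H by (rule assms(1))
  fix i assume i: "i \<in> {1..n}"
  show "s i \<sim> t i"
  proof (rule associatedI)
    show "s i divides t i"
      by (rule squarefree_factor_dvd[of "{1..n}"]) (use assms(3-7) i in auto)
    show "t i divides s i"
      by (rule squarefree_factor_dvd[of "{1..n}"])
        (use assms(3-6) associated_sym[OF assms(7)] i in auto)
  qed
qed

end
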